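(* With probability $1$, the set $\mathbb{T}^d\setminus W[0,t]$ is path-connected, open and dense for every $t$, and the set $\mathbb{T}^d\setminus W[0,\infty)$ is path-connected, locally path-connected and dense.
   Context: Fix an integer $d\ge 3$. $\mathbb{T}^d=\mathbb{R}^d/\mathbb{Z}^d$ is the flat unit torus. $W=(W(t))_{t\ge0}$ is Brownian motion on $\mathbb{T}^d$, i.e. $W(t)=x_0+\tilde W(t)$ with $\tilde W$ a standard Brownian motion on $\mathbb{R}^d$ started at $0$ ($\mathbb{R}^d$ acting on $\mathbb{T}^d$ by translation) and arbitrary starting point $x_0\in\mathbb{T}^d$. $W[0,t]=\{W(s):0\le s\le t\}$ and $W[0,\infty)=\{W(s):s\ge0\}$. *)

theory Defs
  imports "HOL-Probability.Probability"
begin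

definition lattice_equiv :: "real ^ 'n \<Rightarrow> real ^ 'n \<Rightarrow> bool"
  where "lattice_equiv x y \<longleftrightarrow> (\<forall>i. x $ i - y $ i \<in> \<int>)"

lemma equivp_lattice_equiv: "equivp lattice_equiv"
proof (rule equivpI)
  show "reflp lattice_equiv"
    by (simp add: reflp_def lattice_equiv_def)
  show "symp lattice_equiv"
    unfolding symp_def lattice_equiv_def by (metis Ints_minus minus_diff_eq)
  show "transp lattice_equiv"
    unfolding transp_def lattice_equiv_def by (metis Ints_add diff_add_cancel add_diff_eq)
qed

quotient_type (overloaded) 'n torus = "real ^ 'n::finite" / lattice_equiv
  by (rule equivp_lattice_equiv)

lift_definition torus_proj :: "real ^ 'n \<Rightarrow> 'n::finite torus" is "\<lambda>x. x" .

lift_definition torus_translate :: "real ^ 'n \<Rightarrow> 'n::finite torus \<Rightarrow> 'n torus"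
  is "\<lambda>v x. x + v"
  by (simp add: lattice_equiv_def)

text \<open>The quotient topology; it coincides with the topology of the flat metric.\<close>

instantiation torus :: (finite) topological_space
begin

definition open_torus :: "'a torus set \<Rightarrow> bool"
  where "open_torus U \<longleftrightarrow> open (torus_proj -` U)"

instance
  by standard (auto simp: open_torus_def vimage_Union vimage_Int)

end

text \<open>Only times \<open>t \<ge> 0\<close> matter. An increment over \<open>[s, t]\<close> has the Gaussian law with mean
  \<open>0\<close> and covariance matrix \<open>(t - s) I\<close>; its density is the product of the one-dimensional
  ones. The second argument of \<^const>\<open>normal_density\<close> is the standard deviation.\<close>

locale standard_brownian_motion = prob_space M
  for M :: "'a measure" +
  fixes B :: "real \<Rightarrow> 'a \<Rightarrow> real ^ 'n::finite"
  assumes random_variable: "\<And>t. 0 \<le> t \<Longrightarrow> B t \<in> borel_measurable M"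
    and start: "AE \<omega> in M. B 0 \<omega> = 0"
    and independent_increments:
      "\<And>(\<tau> :: nat \<Rightarrow> real) n. 0 \<le> \<tau> 0 \<Longrightarrow> (\<And>i. i < n \<Longrightarrow> \<tau> i \<le> \<tau> (Suc i)) \<Longrightarrow>
        indep_vars (\<lambda>_. borel) (\<lambda>i \<omega>. B (\<tau> (Suc i)) \<omega> - B (\<tau> i) \<omega>) {..<n}"
    and gaussian_increments:
      "\<And>s t. 0 \<le> s \<Longrightarrow> s < t \<Longrightarrow>
        distributed M lborel (\<lambda>\<omega>. B t \<omega> - B s \<omega>)
          (\<lambda>x. ennreal (\<Prod>i\<in>UNIV. normal_density 0 (sqrt (t - s)) (x $ i)))"
    and continuous_paths: "AE \<omega> in M. continuous_on {0..} (\<lambda>t. B t \<omega>)"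

definition torus_brownian_motion ::
    "'a measure \<Rightarrow> 'n::finite torus \<Rightarrow> (real \<Rightarrow> 'a \<Rightarrow> 'n torus) \<Rightarrow> bool"
  where "torus_brownian_motion M x\<^sub>0 W \<longleftrightarrow>
    (\<exists>B. standard_brownian_motion M B \<and>
      (\<forall>t\<ge>0. \<forall>\<omega>\<in>space M. W t \<omega> = torus_translate (B t \<omega>) x\<^sub>0))"

end

theory Submission
  imports Defs
begin

text \<open>Everything happens in the universal cover \<open>\<real>\<^sup>d\<close>. Let \<open>x\<close> be a lift of the starting point, choose an
irrational \<open>c\<close>, and put \<open>D i = x\<^sub>i + c + \<rat>\<close>. The points with all coordinates except at most one in
the corresponding \<open>D i\<close> form a dense net of axis-parallel lines, the skeleton. The theorem follows
from two facts about it.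

The first is probabilistic: almost surely the lifted path and all its lattice translates miss the
skeleton. For \<open>d \<ge> 3\<close> a point of the skeleton has two coordinates \<open>i\<close>, \<open>j\<close> in \<open>D i\<close> and \<open>D j\<close>, so a
visit to the skeleton makes \<open>(B\<^sub>i, B\<^sub>j)\<close> hit one of the countably many points \<open>(c + p, c + q)\<close> with \<open>p\<close>
and \<open>q\<close> rational; lattice translations are absorbed in \<open>\<rat>\<close>. But \<open>(B\<^sub>i, B\<^sub>j)\<close> is a planar Brownian
motion, which almost surely does not hit a given point other than its starting point, and
\<open>c + p \<noteq> 0\<close>. This is \<open>AE_avoids_pair\<close>. Its proof compares expected occupation numbers: sampled on a
fine grid of times, the path visits a square of side of order \<open>r\<close> around a fixed nonzero point
\<open>O(r\<^sup>2/h)\<close> times on average, where \<open>h\<close> is the mesh, while a path that has hit the square returns to a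
square of comparable size about \<open>(r\<^sup>2/h) log (1/r)\<close> times on average, since the density at time \<open>s\<close>
is of order \<open>1/s\<close> and \<open>\<integral> ds/s\<close> diverges at \<open>0\<close>. So the hitting probability is \<open>O(1/log (1/r))\<close>,
uniformly in the mesh.

The second is topological, \<open>path_connected_interval_diff\<close>: if a set \<open>A\<close> misses the skeleton, then
\<open>C - A\<close> is path-connected for every open coordinate box \<open>C\<close>. Two vertices of the net are joined
inside the skeleton by changing one coordinate at a time, and an arbitrary point \<open>y\<close> of \<open>C - A\<close> is
the limit of an infinite broken line in the skeleton, running through vertices that converge to
\<open>y\<close>; only \<open>y\<close> itself could lie in \<open>A\<close>, and it does not. Taking \<open>C = \<real>\<^sup>d\<close> gives path-connectedness
on the torus, small cubes give local path-connectedness, and density holds because vertices are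
dense. Openness for finite times is compactness of the path.\<close>

section \<open>Sets that miss a dense net of axis-parallel lines\<close>

definition axis_skeleton :: "('n \<Rightarrow> real set) \<Rightarrow> (real ^ 'n) set"
  where "axis_skeleton D = {v. \<exists>k. \<forall>i. i \<noteq> k \<longrightarrow> v $ i \<in> D i}"

lemma is_interval_vecD:
  fixes C :: "(real ^ 'n) set"
  assumes "is_interval C" "x \<in> C" "y \<in> C" "\<And>i. v $ i \<in> closed_segment (x $ i) (y $ i)"
  shows "v \<in> C"
proof -
  have "\<forall>b\<in>Basis. (x \<bullet> b \<le> v \<bullet> b \<and> v \<bullet> b \<le> y \<bullet> b) \<or> (y \<bullet> b \<le> v \<bullet> b \<and> v \<bullet> b \<le> x \<bullet> b)"
  proof
    fix b :: "real ^ 'n" assume "b \<in> Basis"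
    then obtain i where "b = axis i 1"
      by (auto simp: Basis_vec_def)
    then show "(x \<bullet> b \<le> v \<bullet> b \<and> v \<bullet> b \<le> y \<bullet> b) \<or> (y \<bullet> b \<le> v \<bullet> b \<and> v \<bullet> b \<le> x \<bullet> b)"
      using assms(4)[of i] by (auto simp: inner_axis closed_segment_eq_real_ivl split: if_splits)
  qed
  then show ?thesis
    using assms(1-3) unfolding is_interval_def by blast
qed

lemma is_interval_cube:
  fixes x :: "real ^ 'n"
  shows "is_interval {v. \<forall>i. \<bar>v $ i - x $ i\<bar> < r}"
  unfolding is_interval_def
proof (intro ballI allI impI)
  fix a b y :: "real ^ 'n"
  assume ab: "a \<in> {v. \<forall>i. \<bar>v $ i - x $ i\<bar> < r}" "b \<in> {v. \<forall>i. \<bar>v $ i - x $ i\<bar> < r}"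
    and between: "\<forall>i\<in>Basis. a \<bullet> i \<le> y \<bullet> i \<and> y \<bullet> i \<le> b \<bullet> i \<or> b \<bullet> i \<le> y \<bullet> i \<and> y \<bullet> i \<le> a \<bullet> i"
  have "\<bar>y $ i - x $ i\<bar> < r" for i
  proof -
    have "axis i 1 \<in> (Basis :: (real ^ 'n) set)"
      by (simp add: axis_in_Basis_iff)
    from between[rule_format, OF this]
    have "a $ i \<le> y $ i \<and> y $ i \<le> b $ i \<or> b $ i \<le> y $ i \<and> y $ i \<le> a $ i"
      by (simp add: inner_axis)
    moreover have "\<bar>a $ i - x $ i\<bar> < r" "\<bar>b $ i - x $ i\<bar> < r"
      using ab by auto
    ultimately show ?thesis
      by linarith
  qed
  then show "y \<in> {v. \<forall>i. \<bar>v $ i - x $ i\<bar> < r}"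
    by simp
qed

lemma cube_subset_ball:
  fixes x :: "real ^ 'n"
  assumes "0 < e"
  shows "{v. \<forall>i. \<bar>v $ i - x $ i\<bar> < e / CARD('n)} \<subseteq> ball x e"
proof
  fix v assume v: "v \<in> {v. \<forall>i. \<bar>v $ i - x $ i\<bar> < e / CARD('n)}"
  have "norm (v - x) \<le> (\<Sum>i\<in>UNIV. \<bar>(v - x) $ i\<bar>)"
    by (rule norm_le_l1_cart)
  also have "\<dots> < (\<Sum>i\<in>(UNIV::'n set). e / CARD('n))"
    using v by (intro sum_strict_mono) auto
  also have "\<dots> = e"
    by simp
  finally show "v \<in> ball x e"
    by (simp add: dist_norm norm_minus_commute)
qed

lemma open_contains_cube:
  fixes x :: "real ^ 'n"
  assumes "open U" "x \<in> U"
  obtains r where "0 < r" "{v. \<forall>i. \<bar>v $ i - x $ i\<bar> < r} \<subseteq> U"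
proof -
  obtain e where "0 < e" "ball x e \<subseteq> U"
    using assms open_contains_ball by blast
  then show ?thesis
    using cube_subset_ball[of e x] by (intro that[of "e / CARD('n)"]) auto
qed

lemma open_cube:
  fixes x :: "real ^ 'n"
  shows "open {v. \<forall>i. \<bar>v $ i - x $ i\<bar> < r}"
proof -
  have "{v. \<forall>i. \<bar>v $ i - x $ i\<bar> < r} = (\<Inter>i. {v. \<bar>v $ i - x $ i\<bar> < r})"
    by auto
  also have "open \<dots>"
    by (intro open_INT ballI open_Collect_less continuous_intros) auto
  finally show ?thesis .
qed

text \<open>Replacing the coordinates of \<open>z\<close> by those of \<open>w\<close> one after another moves along edges of the skeleton,
since at each moment only the coordinate being replaced may leave its set \<open>D i\<close>. All points met
lie coordinatewise between \<open>z\<close> and \<open>w\<close>, hence in \<open>C\<close>.\<close>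

lemma path_component_vertices:
  fixes C :: "(real ^ 'n) set"
  assumes C: "is_interval C" and "z \<in> C" "w \<in> C"
    and z: "\<And>i. z $ i \<in> D i" and w: "\<And>i. w $ i \<in> D i"
  shows "path_component (C \<inter> axis_skeleton D) z w"
proof -
  define mix where "mix F = (\<chi> i. if i \<in> F then w $ i else z $ i)" for F
  have skel: "closed_segment (mix F) (mix (insert k F)) \<subseteq> C \<inter> axis_skeleton D" for F k
  proof
    fix v assume v: "v \<in> closed_segment (mix F) (mix (insert k F))"
    then obtain u where u: "0 \<le> u" "u \<le> 1" "v = (1 - u) *\<^sub>R mix F + u *\<^sub>R mix (insert k F)"
      by (auto simp: closed_segment_def)
    have vi: "v $ i = (1 - u) * mix F $ i + u * mix (insert k F) $ i" for i
      using u(3) by simp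
    have other: "v $ i = mix F $ i" if "i \<noteq> k" for i
      using that by (simp add: vi mix_def algebra_simps)
    have "v $ i \<in> closed_segment (z $ i) (w $ i)" for i
    proof (cases "i = k \<and> k \<notin> F")
      case True
      then show ?thesis
        using u(1,2) by (auto simp: vi mix_def closed_segment_def intro!: exI[of _ u])
    next
      case False
      then have "v $ i = (if i \<in> F then w $ i else z $ i)"
        by (auto simp: vi mix_def algebra_simps)
      then show ?thesis
        by simp
    qed
    then have "v \<in> C"
      using is_interval_vecD[OF C \<open>z \<in> C\<close> \<open>w \<in> C\<close>] by blast
    moreover have "v \<in> axis_skeleton D"
      unfolding axis_skeleton_def using z w other by (auto simp: mix_def intro!: exI[of _ k])
    ultimately show "v \<in> C \<inter> axis_skeleton D"
      by blast
  qed
  have "path_component (C \<inter> axis_skeleton D) z (mix F)" if "finite F" for F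
    using that
  proof (induction F rule: finite_induct)
    case empty
    have "mix {} = z"
      by (simp add: mix_def vec_eq_iff)
    then show ?case
      using skel[of "{}"] by (auto intro!: path_component_refl)
  next
    case (insert k F)
    have "path_component (C \<inter> axis_skeleton D) (mix F) (mix (insert k F))"
      unfolding path_component_def
      using skel[of F k] by (intro exI[of _ "linepath (mix F) (mix (insert k F))"]) auto
    then show ?case
      using insert.IH path_component_trans by blast
  qed
  from this[of UNIV] show ?thesis
    by (simp add: mix_def)
qed

text \<open>Infinite concatenation of paths: run through the \<open>n\<close>-th path during \<open>[n, n + 1]\<close> and compress
\<open>[0, \<infinity>)\<close> to \<open>[0, 1)\<close>. The shrinking of the sets \<open>S n\<close> towards \<open>x\<close> is exactly continuity at the new
endpoint.\<close>

lemma path_component_infinite_join: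
  fixes x :: "'a :: metric_space" and z :: "nat \<Rightarrow> 'a"
  assumes step: "\<And>n. path_component (S n) (z n) (z (Suc n))"
    and sub: "\<And>n. S n \<subseteq> T"
    and small: "\<And>e. 0 < e \<Longrightarrow> \<exists>N. \<forall>n\<ge>N. S n \<subseteq> ball x e"
    and "x \<in> T"
  shows "path_component T (z 0) x"
proof -
  from step have "\<exists>\<gamma>. path \<gamma> \<and> path_image \<gamma> \<subseteq> S n \<and> pathstart \<gamma> = z n \<and> pathfinish \<gamma> = z (Suc n)" for n
    unfolding path_component_def by blast
  then obtain \<gamma> where \<gamma>: "\<And>n. path (\<gamma> n)" "\<And>n. path_image (\<gamma> n) \<subseteq> S n"
      "\<And>n. \<gamma> n 0 = z n" "\<And>n. \<gamma> n 1 = z (Suc n)"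
    unfolding pathstart_def pathfinish_def by metis
  define g where "g t = \<gamma> (nat \<lfloor>t\<rfloor>) (t - \<lfloor>t\<rfloor>)" for t :: real
  have g_piece: "g t = \<gamma> n (t - n)" if "t \<in> {real n..real n + 1}" for n t
  proof (cases "t = real n + 1")
    case True
    then have "nat \<lfloor>t\<rfloor> = Suc n" "\<lfloor>t\<rfloor> = int n + 1"
      by linarith+
    then show ?thesis
      using True by (simp add: g_def \<gamma>)
  next
    case False
    then have "\<lfloor>t\<rfloor> = int n"
      using that by (auto simp: floor_eq_iff)
    then show ?thesis
      by (simp add: g_def)
  qed
  have g_mem: "g t \<in> S (nat \<lfloor>t\<rfloor>)" if "0 \<le> t" for t
  proof -
    have "t - \<lfloor>t\<rfloor> \<in> {0..1}"
      by simp linarith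
    then show ?thesis
      using \<gamma>(2)[of "nat \<lfloor>t\<rfloor>"] by (auto simp: g_def path_image_def)
  qed
  have cont_n: "continuous_on {0..real n} g" for n
  proof (induction n)
    case 0
    then show ?case
      by simp
  next
    case (Suc n)
    have "continuous_on {real n..real n + 1} (\<lambda>t. \<gamma> n (t - n))"
      using \<gamma>(1)[of n] unfolding path_def
      by (rule continuous_on_compose2) (auto intro!: continuous_intros)
    then have "continuous_on {real n..real n + 1} g"
      by (subst continuous_on_cong[OF refl g_piece]) auto
    with Suc have "continuous_on ({0..real n} \<union> {real n..real n + 1}) g"
      by (intro continuous_on_closed_Un) auto
    moreover have "{0..real n} \<union> {real n..real n + 1} = {0..real (Suc n)}"
      by auto
    ultimately show ?case
      by simp
  qed
  have cont: "continuous_on {0..} g"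
    unfolding continuous_on_eq_continuous_within
  proof
    fix t :: real assume "t \<in> {0..}"
    obtain n :: nat where n: "t < n"
      using reals_Archimedean2 by blast
    have "continuous (at t within {0..real n}) g"
      using cont_n[of n] n \<open>t \<in> {0..}\<close> by (auto simp: continuous_on_eq_continuous_within)
    moreover have "at t within {0..real n} = at t within {0..}"
      by (rule at_within_nhd[of _ "{..<real n}"]) (use n in auto)
    ultimately show "continuous (at t within {0..}) g"
      by simp
  qed
  define p where "p s = (if s = 1 then x else g (s / (1 - s)))" for s :: real
  have cont_p: "continuous_on {0..<1} p"
  proof -
    have "continuous_on {0..<1} (\<lambda>s. g (s / (1 - s)))"
      by (rule continuous_on_compose2[OF cont]) (auto intro!: continuous_intros)
    then show ?thesis
      by (rule continuous_on_eq) (auto simp: p_def)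
  qed
  have "path p"
    unfolding path_def continuous_on_eq_continuous_within
  proof
    fix s :: real assume s: "s \<in> {0..1}"
    show "continuous (at s within {0..1}) p"
    proof (cases "s = 1")
      case False
      then have "continuous (at s within {0..<1}) p"
        using cont_p s by (auto simp: continuous_on_eq_continuous_within)
      moreover have "at s within {0..<1} = at s within {0..1}"
        by (rule at_within_nhd[of _ "{..<1}"]) (use s False in auto)
      ultimately show ?thesis
        by simp
    next
      case True
      show ?thesis
        unfolding continuous_within_eps_delta True
      proof (intro allI impI)
        fix e :: real assume "e > 0"
        then obtain N where N: "\<And>n. n \<ge> N \<Longrightarrow> S n \<subseteq> ball x e"
          using small by blast
        have "dist (p s') (p 1) < e" if "s' \<in> {0..1}" "dist s' 1 < 1 / (real N + 1)" for s'
        proof (cases "s' = 1")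
          case True
          then show ?thesis
            using \<open>e > 0\<close> by simp
        next
          case False
          with that have s': "0 \<le> s'" "s' < 1" "1 - s' < 1 / (real N + 1)"
            by (auto simp: dist_real_def)
          then have "real N \<le> s' / (1 - s')"
            by (simp add: field_simps)
          then have "N \<le> nat \<lfloor>s' / (1 - s')\<rfloor>"
            by (simp add: le_nat_floor)
          moreover have "g (s' / (1 - s')) \<in> S (nat \<lfloor>s' / (1 - s')\<rfloor>)"
            using s' by (intro g_mem) auto
          ultimately have "g (s' / (1 - s')) \<in> ball x e"
            using N by blast
          then show ?thesis
            using False by (simp add: p_def dist_commute)
        qed
        then show "\<exists>d>0. \<forall>s'\<in>{0..1}. dist s' 1 < d \<longrightarrow> dist (p s') (p 1) < e"
          by (intro exI[of _ "1 / (real N + 1)"]) auto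
      qed
    qed
  qed
  moreover have "path_image p \<subseteq> T"
  proof -
    have "p s \<in> T" if "s \<in> {0..1}" for s
    proof (cases "s = 1")
      case False
      then have "g (s / (1 - s)) \<in> S (nat \<lfloor>s / (1 - s)\<rfloor>)"
        using that by (intro g_mem) auto
      then show ?thesis
        using sub False by (auto simp: p_def)
    qed (simp add: p_def \<open>x \<in> T\<close>)
    then show ?thesis
      by (auto simp: path_image_def)
  qed
  moreover have "pathstart p = z 0" "pathfinish p = x"
    using \<gamma>(3)[of 0] by (simp_all add: pathstart_def pathfinish_def p_def g_def)
  ultimately show ?thesis
    unfolding path_component_def by blast
qed

lemma vertex_in_cube:
  fixes x :: "real ^ 'n" and r :: real
  assumes dense: "\<And>i. closure (D i) = UNIV" and "0 < r"
  shows "\<exists>z. (\<forall>i. z $ i \<in> D i) \<and> (\<forall>i. \<bar>z $ i - x $ i\<bar> < r)"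
proof -
  have "\<exists>a\<in>D i. \<bar>a - x $ i\<bar> < r" for i
    using dense[of i] \<open>0 < r\<close> closure_approachable[of "x $ i" "D i"] by (auto simp: dist_real_def)
  then obtain a where "\<And>i. a i \<in> D i" "\<And>i. \<bar>a i - x $ i\<bar> < r"
    by metis
  then show ?thesis
    by (intro exI[of _ "\<chi> i. a i"]) auto
qed

text \<open>The axis-parallel lines through \<open>x\<close> are in general not part of the skeleton, so no finite broken line
will do; but vertices \<open>z\<^sub>n\<close> that approach \<open>x\<close> can be joined within the skeleton inside cubes that
shrink to \<open>x\<close>.\<close>

lemma path_component_to_vertex:
  fixes C :: "(real ^ 'n) set"
  assumes dense: "\<And>i. closure (D i) = UNIV" and "open C" "x \<in> C"
  shows "\<exists>z\<in>C. (\<forall>i. z $ i \<in> D i) \<and> path_component (insert x (C \<inter> axis_skeleton D)) z x"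
proof -
  define Q where "Q r = {v :: real ^ 'n. \<forall>i. \<bar>v $ i - x $ i\<bar> < r}" for r
  obtain r where r: "0 < r" "Q r \<subseteq> C"
    using open_contains_cube[OF assms(2,3)] unfolding Q_def by blast
  define \<rho> where "\<rho> n = r / (real n + 1)" for n
  have \<rho>: "0 < \<rho> n" "\<rho> n \<le> r" "\<rho> (Suc n) \<le> \<rho> n" for n
    using r(1) by (auto simp: \<rho>_def field_simps)
  have mono: "Q a \<subseteq> Q b" if "a \<le> b" for a b
    unfolding Q_def using that by (auto intro: less_le_trans)
  have "\<exists>z. (\<forall>i. z $ i \<in> D i) \<and> z \<in> Q (\<rho> n)" for n
    using vertex_in_cube[of D "\<rho> n" x, OF dense \<rho>(1)] unfolding Q_def by simp
  then obtain z where z: "\<And>n i. z n $ i \<in> D i" "\<And>n. z n \<in> Q (\<rho> n)"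
    by metis
  have "path_component (insert x (C \<inter> axis_skeleton D)) (z 0) x"
  proof (rule path_component_infinite_join[where S = "\<lambda>n. Q (\<rho> n) \<inter> axis_skeleton D"])
    fix n
    have "z (Suc n) \<in> Q (\<rho> n)"
      using z(2) mono \<rho>(3) by blast
    then show "path_component (Q (\<rho> n) \<inter> axis_skeleton D) (z n) (z (Suc n))"
      using z is_interval_cube unfolding Q_def by (intro path_component_vertices) auto
    show "Q (\<rho> n) \<inter> axis_skeleton D \<subseteq> insert x (C \<inter> axis_skeleton D)"
      using mono[OF \<rho>(2)] r(2) by blast
  next
    fix e :: real assume "0 < e"
    have "\<rho> \<longlonglongrightarrow> 0"
      unfolding \<rho>_def using LIMSEQ_Suc[OF lim_const_over_n[of r]] by (simp add: add.commute)
    moreover have "0 < e / CARD('n)"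
      using \<open>0 < e\<close> by simp
    ultimately obtain N where N: "\<And>n. n \<ge> N \<Longrightarrow> \<rho> n < e / CARD('n)"
      using order_tendstoD(2)[of \<rho> 0 sequentially "e / CARD('n)"] by (auto simp: eventually_sequentially)
    have "Q (\<rho> n) \<inter> axis_skeleton D \<subseteq> ball x e" if "n \<ge> N" for n
      using mono[OF less_imp_le[OF N[OF that]]] cube_subset_ball[OF \<open>0 < e\<close>, of x]
      unfolding Q_def by blast
    then show "\<exists>N. \<forall>n\<ge>N. Q (\<rho> n) \<inter> axis_skeleton D \<subseteq> ball x e"
      by blast
  qed simp
  moreover have "z 0 \<in> C"
    using z(2)[of 0] mono[OF \<rho>(2)[of 0]] r(2) by blast
  ultimately show ?thesis
    using z(1) by blast
qed

text \<open>This is the topological core: avoiding the skeleton is enough, whatever else \<open>A\<close> looks like. In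
particular \<open>A\<close> may be dense.\<close>

lemma path_connected_interval_diff:
  fixes C :: "(real ^ 'n) set"
  assumes dense: "\<And>i. closure (D i) = UNIV" and C: "open C" "is_interval C"
    and A: "A \<inter> axis_skeleton D = {}"
  shows "path_connected (C - A)"
  unfolding path_connected_component
proof (intro ballI)
  fix x y assume x: "x \<in> C - A" and y: "y \<in> C - A"
  obtain z where z: "z \<in> C" "\<And>i. z $ i \<in> D i"
      "path_component (insert x (C \<inter> axis_skeleton D)) z x"
    using path_component_to_vertex[of D C x, OF dense C(1)] x by auto
  obtain w where w: "w \<in> C" "\<And>i. w $ i \<in> D i"
      "path_component (insert y (C \<inter> axis_skeleton D)) w y"
    using path_component_to_vertex[of D C y, OF dense C(1)] y by auto
  have "path_component (C \<inter> axis_skeleton D) z w"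
    by (rule path_component_vertices[OF C(2) z(1) w(1) z(2) w(2)])
  moreover have "insert x (C \<inter> axis_skeleton D) \<subseteq> C - A" "insert y (C \<inter> axis_skeleton D) \<subseteq> C - A"
    using x y A by blast+
  ultimately have "path_component (C - A) z x" "path_component (C - A) z w" "path_component (C - A) w y"
    using z(3) w(3) by (meson path_component_of_subset le_infI1 order_trans subset_insertI)+
  then show "path_component (C - A) x y"
    by (meson path_component_trans path_component_sym)
qed

section \<open>Passage to the torus\<close>

lemma torus_proj_eq_iff: "torus_proj x = torus_proj y \<longleftrightarrow> (\<forall>i. x $ i - y $ i \<in> \<int>)"
  by transfer (simp add: lattice_equiv_def)

lemma torus_proj_surj: "\<exists>x. p = torus_proj x"
  by transfer (rule exI, rule equivp_reflp[OF equivp_lattice_equiv])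

lemma torus_translate_proj: "torus_translate v (torus_proj x) = torus_proj (x + v)"
  by transfer (simp add: lattice_equiv_def)

lemma continuous_on_torus_proj: "continuous_on S torus_proj"
proof -
  have "continuous_on UNIV (torus_proj :: real ^ 'n \<Rightarrow> _)"
    by (simp add: continuous_on_open_vimage open_torus_def)
  then show ?thesis
    using continuous_on_subset by blast
qed

lemma torus_proj_vimage_image:
  fixes S :: "(real ^ 'n::finite) set"
  shows "torus_proj -` torus_proj ` S = (\<Union>k\<in>{k. \<forall>i. k $ i \<in> \<int>}. (+) k ` S)"
proof safe
  fix x y :: "real ^ 'n" assume "y \<in> S" "torus_proj x = torus_proj y"
  then show "x \<in> (\<Union>k\<in>{k. \<forall>i. k $ i \<in> \<int>}. (+) k ` S)"
    by (intro UN_I[of "x - y"]) (auto simp: torus_proj_eq_iff intro!: image_eqI[of _ _ y])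
next
  fix k y :: "real ^ 'n" assume "\<forall>i. k $ i \<in> \<int>" "y \<in> S"
  then show "k + y \<in> torus_proj -` torus_proj ` S"
    by (auto simp: torus_proj_eq_iff intro!: image_eqI[of _ _ y])
qed

lemma open_torus_proj_image:
  assumes "open U"
  shows "open (torus_proj ` U)"
  unfolding open_torus_def torus_proj_vimage_image using assms by (auto intro: open_translation)

text \<open>The preimage of the image is the sum of a compact set and the closed lattice, hence closed.\<close>

lemma closed_torus_proj_image:
  fixes K :: "(real ^ 'n) set"
  assumes "compact K"
  shows "closed (torus_proj ` K)"
proof -
  have "closed {k :: real ^ 'n. \<forall>i. k $ i \<in> \<int>}"
  proof -
    have "{k :: real ^ 'n. \<forall>i. k $ i \<in> \<int>} = (\<Inter>i. (\<lambda>k. k $ i) -` \<int>)"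
      by auto
    also have "closed \<dots>"
      by (intro closed_INT ballI continuous_closed_vimage) (auto intro!: continuous_intros)
    finally show ?thesis .
  qed
  then have "closed (\<Union>k\<in>{k :: real ^ 'n. \<forall>i. k $ i \<in> \<int>}. \<Union>y\<in>K. {k + y})"
    using assms by (rule closed_compact_sums)
  also have "(\<Union>k\<in>{k :: real ^ 'n. \<forall>i. k $ i \<in> \<int>}. \<Union>y\<in>K. {k + y}) = torus_proj -` torus_proj ` K"
    unfolding torus_proj_vimage_image by auto
  finally show ?thesis
    by (simp add: closed_def open_torus_def vimage_Compl)
qed

text \<open>The projection is continuous, surjective and open, and maps the complement of the full preimage of
\<open>A\<close> in \<open>C\<close> onto the complement of \<open>A\<close> in the image of \<open>C\<close>. So the properties descend from the whole
space, from small cubes, and from the dense set of vertices.\<close>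

lemma torus_complement_connectivity:
  fixes A :: "'n::finite torus set"
  assumes dense: "\<And>i. closure (D i) = UNIV"
    and A: "torus_proj -` A \<inter> axis_skeleton D = {}"
  shows "path_connected (UNIV - A)" "locally path_connected (UNIV - A)" "closure (UNIV - A) = UNIV"
proof -
  have image: "torus_proj ` (C - torus_proj -` A) = torus_proj ` C - A" for C
    by auto
  have pc: "path_connected (torus_proj ` C - A)" if "open C" "is_interval C" for C
    unfolding image[symmetric]
    by (intro path_connected_continuous_image continuous_on_torus_proj
        path_connected_interval_diff[OF dense that A])
  have "range torus_proj = (UNIV :: 'n torus set)"
    using torus_proj_surj by blast
  with pc[of UNIV] show "path_connected (UNIV - A)"
    by simp
  show "locally path_connected (UNIV - A)"
  proof (rule locallyI)
    fix w p assume w: "openin (top_of_set (UNIV - A)) w" "p \<in> w"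
    then obtain U where U: "open U" "w = (UNIV - A) \<inter> U"
      by (auto simp: openin_open)
    obtain x where x: "p = torus_proj x"
      using torus_proj_surj by blast
    have "open (torus_proj -` U)" "x \<in> torus_proj -` U"
      using U w x by (auto simp: open_torus_def)
    then obtain r where r: "0 < r" "{v. \<forall>i. \<bar>v $ i - x $ i\<bar> < r} \<subseteq> torus_proj -` U"
      using open_contains_cube by blast
    let ?Q = "{v :: real ^ 'n. \<forall>i. \<bar>v $ i - x $ i\<bar> < r}"
    have "openin (top_of_set (UNIV - A)) (torus_proj ` ?Q - A)"
      using open_torus_proj_image[OF open_cube[of x r]] by (auto simp: openin_open)
    moreover have "path_connected (torus_proj ` ?Q - A)"
      by (rule pc[OF open_cube is_interval_cube])
    moreover have "p \<in> torus_proj ` ?Q - A"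
      using x r(1) w(2) U(2) by auto
    moreover have "torus_proj ` ?Q - A \<subseteq> w"
      using r(2) U(2) by auto
    ultimately show "\<exists>u v. openin (top_of_set (UNIV - A)) u \<and> path_connected v \<and> p \<in> u \<and> u \<subseteq> v \<and> v \<subseteq> w"
      by blast
  qed
  have "U \<inter> (UNIV - A) \<noteq> {}" if "open U" "p \<in> U" for U p
  proof -
    obtain x where x: "p = torus_proj x"
      using torus_proj_surj by blast
    have "open (torus_proj -` U)" "x \<in> torus_proj -` U"
      using that x by (auto simp: open_torus_def)
    then obtain r where r: "0 < r" "{v. \<forall>i. \<bar>v $ i - x $ i\<bar> < r} \<subseteq> torus_proj -` U"
      using open_contains_cube by blast
    obtain z where z: "\<forall>i. z $ i \<in> D i" "\<forall>i. \<bar>z $ i - x $ i\<bar> < r"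
      using vertex_in_cube[of D r x, OF dense r(1)] by blast
    have "z \<in> axis_skeleton D"
      using z(1) by (auto simp: axis_skeleton_def)
    then have "torus_proj z \<notin> A"
      using A by blast
    then show ?thesis
      using z(2) r(2) by blast
  qed
  then show "closure (UNIV - A) = UNIV"
    by (auto simp: closure_iff_nhds_not_empty) blast
qed

section \<open>Gaussian estimates on small intervals\<close>

text \<open>The argument \<open>s\<close> is the variance, which for a Brownian increment is the elapsed time.\<close>

definition normal_mass :: "real \<Rightarrow> real \<Rightarrow> real \<Rightarrow> real"
  where "normal_mass s a r = measure (density lborel (normal_density 0 (sqrt s))) {a - r<..<a + r}"

lemma normal_mass_nonneg: "0 \<le> normal_mass s a r"
  by (simp add: normal_mass_def)

lemma normal_mass_emeasure:
  assumes "0 < s"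
  shows "ennreal (normal_mass s a r) =
    (\<integral>\<^sup>+x. ennreal (normal_density 0 (sqrt s) x) * indicator {a - r<..<a + r} x \<partial>lborel)"
proof -
  interpret N: prob_space "density lborel (normal_density 0 (sqrt s))"
    using assms by (intro prob_space_normal_density) simp
  show ?thesis
    unfolding normal_mass_def N.emeasure_eq_measure[symmetric] by (simp add: emeasure_density)
qed

lemma normal_mass_le:
  assumes "0 < s" "0 \<le> r" "0 \<le> c"
    and "\<And>x. x \<in> {a - r<..<a + r} \<Longrightarrow> normal_density 0 (sqrt s) x \<le> c"
  shows "normal_mass s a r \<le> 2 * r * c"
proof -
  have "ennreal (normal_mass s a r) \<le> (\<integral>\<^sup>+x. ennreal c * indicator {a - r<..<a + r} x \<partial>lborel)"
    unfolding normal_mass_emeasure[OF assms(1)]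
    using assms(4) by (intro nn_integral_mono) (auto split: split_indicator intro: ennreal_leI)
  also have "\<dots> = ennreal (2 * r * c)"
    using assms by (simp add: nn_integral_cmult ennreal_mult[symmetric] algebra_simps)
  finally show ?thesis
    using assms by (subst (asm) ennreal_le_iff) auto
qed

lemma normal_mass_ge:
  assumes "0 < s" "0 \<le> r" "0 \<le> c"
    and "\<And>x. x \<in> {a - r<..<a + r} \<Longrightarrow> c \<le> normal_density 0 (sqrt s) x"
  shows "2 * r * c \<le> normal_mass s a r"
proof -
  have "ennreal (2 * r * c) = (\<integral>\<^sup>+x. ennreal c * indicator {a - r<..<a + r} x \<partial>lborel)"
    using assms by (simp add: nn_integral_cmult ennreal_mult[symmetric] algebra_simps)
  also have "\<dots> \<le> ennreal (normal_mass s a r)"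
    unfolding normal_mass_emeasure[OF assms(1)]
    using assms(4) by (intro nn_integral_mono) (auto split: split_indicator intro: ennreal_leI)
  finally show ?thesis
    by (simp add: normal_mass_nonneg)
qed

text \<open>For the upper bound on the occupation numbers. The factor \<open>1/s\<close> of the planar density is
compensated by the Gaussian tail, because the square stays at distance at least \<open>\<bar>a\<bar>/2\<close> from the
origin; so the bound is uniform in the variance \<open>s\<close>.\<close>

lemma normal_mass_product_le:
  assumes "0 < s" "0 < r" "r \<le> \<bar>a\<bar> / 2"
  shows "normal_mass s a r * normal_mass s b r \<le> 16 * r\<^sup>2 / (pi * a\<^sup>2)"
proof -
  have a: "0 < a\<^sup>2"
    using assms by auto
  define C where "C = 1 / sqrt (2 * pi * s)"
  have C: "0 \<le> C" "C\<^sup>2 = 1 / (2 * pi * s)"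
    using assms by (auto simp: C_def power_divide)
  have density: "normal_density 0 (sqrt s) x = C * exp (- x\<^sup>2 / (2 * s))" for x
    using assms by (simp add: normal_density_def C_def)
  have "normal_mass s a r \<le> 2 * r * (C * exp (- (a\<^sup>2 / (8 * s))))"
  proof (rule normal_mass_le)
    fix x assume "x \<in> {a - r<..<a + r}"
    then have "\<bar>a\<bar> / 2 \<le> \<bar>x\<bar>"
      using assms(3) by auto
    then have "(\<bar>a\<bar> / 2)\<^sup>2 \<le> \<bar>x\<bar>\<^sup>2"
      by (intro power_mono) auto
    then have "- x\<^sup>2 / (2 * s) \<le> - (a\<^sup>2 / (8 * s))"
      using assms(1) by (simp add: power_divide field_simps)
    then show "normal_density 0 (sqrt s) x \<le> C * exp (- (a\<^sup>2 / (8 * s)))"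
      using C(1) by (simp add: density mult_left_mono)
  qed (use assms C in auto)
  moreover have "normal_mass s b r \<le> 2 * r * C"
  proof (rule normal_mass_le)
    fix x show "normal_density 0 (sqrt s) x \<le> C"
      using C(1) assms(1) by (auto simp: density intro!: mult_left_le)
  qed (use assms C in auto)
  ultimately have "normal_mass s a r * normal_mass s b r
      \<le> (2 * r * (C * exp (- (a\<^sup>2 / (8 * s))))) * (2 * r * C)"
    using assms C by (intro mult_mono) (auto simp: normal_mass_nonneg)
  also have "\<dots> = 4 * r\<^sup>2 * C\<^sup>2 * exp (- (a\<^sup>2 / (8 * s)))"
    by (simp add: power2_eq_square)
  also have "\<dots> \<le> 4 * r\<^sup>2 * C\<^sup>2 * (8 * s / a\<^sup>2)"
  proof (rule mult_left_mono)
    have "a\<^sup>2 / (8 * s) \<le> exp (a\<^sup>2 / (8 * s))"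
      by (rule order_trans[OF _ exp_ge_add_one_self]) simp
    then have "inverse (exp (a\<^sup>2 / (8 * s))) \<le> inverse (a\<^sup>2 / (8 * s))"
      using a assms(1) by (intro le_imp_inverse_le) auto
    then show "exp (- (a\<^sup>2 / (8 * s))) \<le> 8 * s / a\<^sup>2"
      by (simp add: exp_minus)
  qed simp
  also have "\<dots> = 16 * r\<^sup>2 / (pi * a\<^sup>2)"
    using assms(1) by (simp add: C(2) field_simps)
  finally show ?thesis .
qed

text \<open>For the lower bound on the number of returns. At the scale \<open>r\<^sup>2 \<le> s\<close> the exponential is bounded below
and the mass of the square is of order \<open>r\<^sup>2/s\<close>; its sum over times produces the logarithm.\<close>

lemma normal_mass_square_ge:
  assumes "0 < r" "r\<^sup>2 \<le> s"
  shows "2 * r\<^sup>2 / (pi * exp 1 * s) \<le> normal_mass s 0 r * normal_mass s 0 r"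
proof -
  have s: "0 < s"
    using assms by (meson less_le_trans zero_less_power)
  define c where "c = 1 / sqrt (2 * pi * s) * exp (- 1 / 2)"
  have "2 * r * c \<le> normal_mass s 0 r"
  proof (rule normal_mass_ge)
    fix x assume "x \<in> {0 - r<..<0 + r}"
    then have "\<bar>x\<bar>\<^sup>2 \<le> r\<^sup>2"
      by (intro power_mono) auto
    then have "- 1 / 2 \<le> - x\<^sup>2 / (2 * s)"
      using assms(2) s by (simp add: field_simps)
    then show "c \<le> normal_density 0 (sqrt s) x"
      using s by (simp add: normal_density_def c_def divide_right_mono)
  qed (use assms s in \<open>auto simp: c_def\<close>)
  moreover have "0 \<le> c"
    using s by (simp add: c_def)
  ultimately have "(2 * r * c) * (2 * r * c) \<le> normal_mass s 0 r * normal_mass s 0 r"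
    using assms by (intro mult_mono) (auto simp: normal_mass_nonneg)
  moreover have "c\<^sup>2 = 1 / (2 * pi * s) * exp (- 1)"
    using s by (simp add: c_def power_mult_distrib power_divide exp_double[symmetric])
  then have "(2 * r * c) * (2 * r * c) = 2 * r\<^sup>2 / (pi * exp 1 * s)"
    using s by (simp add: power2_eq_square[symmetric] power_mult_distrib exp_minus field_simps)
  ultimately show ?thesis
    by simp
qed

lemma harmonic_block_sum_ge: "real k / 2 \<le> (\<Sum>j\<in>{2 ^ n<..2 ^ (n + k)}. 1 / real j)"
proof (induction k)
  case 0
  then show ?case
    by simp
next
  case (Suc k)
  have card: "card {2 ^ (n + k)<..2 ^ (n + Suc k)::nat} = 2 ^ (n + k)"
    by simp
  have "1 / 2 = (\<Sum>j\<in>{2 ^ (n + k)<..2 ^ (n + Suc k)::nat}. 1 / real (2 ^ (n + Suc k)))"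
    unfolding sum_constant card by simp
  also have "\<dots> \<le> (\<Sum>j\<in>{2 ^ (n + k)<..2 ^ (n + Suc k)}. 1 / real j)"
  proof (rule sum_mono)
    fix j :: nat assume "j \<in> {2 ^ (n + k)<..2 ^ (n + Suc k)}"
    then have "0 < j" "j \<le> 2 ^ (n + Suc k)"
      by auto
    then show "1 / real (2 ^ (n + Suc k)) \<le> 1 / real j"
      by (intro divide_left_mono of_nat_mono) auto
  qed
  finally have "real (Suc k) / 2 \<le> (\<Sum>j\<in>{2 ^ n<..2 ^ (n + k)}. 1 / real j)
      + (\<Sum>j\<in>{2 ^ (n + k)<..2 ^ (n + Suc k)}. 1 / real j)"
    using Suc by simp
  also have "\<dots> = (\<Sum>j\<in>{2 ^ n<..2 ^ (n + k)} \<union> {2 ^ (n + k)<..2 ^ (n + Suc k)}. 1 / real j)"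
    by (rule sum.union_disjoint[symmetric]) auto
  also have "{2 ^ n<..2 ^ (n + k)} \<union> {2 ^ (n + k)<..2 ^ (n + Suc k)} = {2 ^ n<..2 ^ (n + Suc k)::nat}"
    by (intro ivl_disj_un) (auto intro: power_increasing)
  finally show ?case .
qed

section \<open>Planar Brownian motion does not hit points\<close>

text \<open>Decompose at the first entrance into \<open>H\<close>. After an entrance at step \<open>k\<close>, each further increment that
lies in \<open>G\<close> puts the walk into \<open>H'\<close>, independently of the past; so on average an entrance by
step \<open>m\<close> forces at least \<open>\<Sum>j=1..m. g j\<close> visits to \<open>H'\<close> up to step \<open>2 m\<close>. Used as an upper bound on
the probability of entering \<open>H\<close>.\<close>

lemma (in prob_space) first_entrance_bound:
  fixes S :: "nat \<Rightarrow> 'a \<Rightarrow> 'b :: euclidean_space" and g :: "nat \<Rightarrow> real"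
  assumes [measurable]: "\<And>k. S k \<in> borel_measurable M"
    and [measurable]: "H \<in> sets borel" "G \<in> sets borel" "H' \<in> sets borel"
    and indep: "\<And>k j. 1 \<le> j \<Longrightarrow> prob {\<omega> \<in> space M. (S k \<omega> \<in> H \<and> (\<forall>l<k. S l \<omega> \<notin> H)) \<and> S (k + j) \<omega> - S k \<omega> \<in> G} =
      prob {\<omega> \<in> space M. S k \<omega> \<in> H \<and> (\<forall>l<k. S l \<omega> \<notin> H)} * g j"
    and sub: "\<And>u v. u \<in> H \<Longrightarrow> v \<in> G \<Longrightarrow> u + v \<in> H'"
  shows "prob {\<omega> \<in> space M. \<exists>k\<le>m. S k \<omega> \<in> H} * (\<Sum>j=1..m. g j)
    \<le> (\<Sum>l=1..2*m. prob {\<omega> \<in> space M. S l \<omega> \<in> H'})"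
proof -
  define F where "F k = {\<omega> \<in> space M. S k \<omega> \<in> H \<and> (\<forall>l<k. S l \<omega> \<notin> H)}" for k
  define E where "E l = {\<omega> \<in> space M. S l \<omega> \<in> H'}" for l
  have [measurable]: "F k \<in> events" "E k \<in> events" for k
    by (auto simp: F_def E_def)
  have disj: "disjoint_family_on F {..m}"
    unfolding disjoint_family_on_def
  proof (intro ballI impI)
    fix k l :: nat assume "k \<noteq> l"
    then show "F k \<inter> F l = {}"
      by (cases k l rule: linorder_cases) (auto simp: F_def)
  qed
  have "{\<omega> \<in> space M. \<exists>k\<le>m. S k \<omega> \<in> H} = (\<Union>k\<in>{..m}. F k)"
  proof (intro set_eqI iffI)
    fix \<omega> assume "\<omega> \<in> {\<omega> \<in> space M. \<exists>k\<le>m. S k \<omega> \<in> H}"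
    then obtain k where k: "\<omega> \<in> space M" "k \<le> m" "S k \<omega> \<in> H"
      by auto
    define k0 where "k0 = (LEAST k. S k \<omega> \<in> H)"
    have "S k0 \<omega> \<in> H" "k0 \<le> k" "\<forall>l<k0. S l \<omega> \<notin> H"
      using k(3) unfolding k0_def by (auto intro: LeastI Least_le dest: not_less_Least)
    then show "\<omega> \<in> (\<Union>k\<in>{..m}. F k)"
      using k by (auto simp: F_def intro!: bexI[of _ k0])
  qed (auto simp: F_def)
  then have "prob {\<omega> \<in> space M. \<exists>k\<le>m. S k \<omega> \<in> H} = (\<Sum>k\<le>m. prob (F k))"
    using finite_measure_finite_Union[OF _ _ disj] by (simp add: image_subset_iff)
  then have "prob {\<omega> \<in> space M. \<exists>k\<le>m. S k \<omega> \<in> H} * (\<Sum>j=1..m. g j)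
      = (\<Sum>k\<le>m. \<Sum>j=1..m. prob (F k) * g j)"
    by (simp add: sum_product)
  also have "\<dots> \<le> (\<Sum>k\<le>m. \<Sum>l=1..2*m. prob (F k \<inter> E l))"
  proof (rule sum_mono)
    fix k assume k: "k \<in> {..m}"
    have "(\<Sum>j=1..m. prob (F k) * g j) \<le> (\<Sum>j=1..m. prob (F k \<inter> E (k + j)))"
    proof (rule sum_mono)
      fix j assume "j \<in> {1..m}"
      then have "prob (F k) * g j =
          prob {\<omega> \<in> space M. (S k \<omega> \<in> H \<and> (\<forall>l<k. S l \<omega> \<notin> H)) \<and> S (k + j) \<omega> - S k \<omega> \<in> G}"
        unfolding F_def by (intro indep[symmetric]) simp
      also have "\<dots> \<le> prob (F k \<inter> E (k + j))"
      proof (rule finite_measure_mono)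
        show "{\<omega> \<in> space M. (S k \<omega> \<in> H \<and> (\<forall>l<k. S l \<omega> \<notin> H)) \<and> S (k + j) \<omega> - S k \<omega> \<in> G}
            \<subseteq> F k \<inter> E (k + j)"
        proof
          fix \<omega> assume \<omega>: "\<omega> \<in> {\<omega> \<in> space M. (S k \<omega> \<in> H \<and> (\<forall>l<k. S l \<omega> \<notin> H)) \<and> S (k + j) \<omega> - S k \<omega> \<in> G}"
          then have "S k \<omega> + (S (k + j) \<omega> - S k \<omega>) \<in> H'"
            by (intro sub) auto
          then show "\<omega> \<in> F k \<inter> E (k + j)"
            using \<omega> by (simp add: F_def E_def)
        qed
      qed measurable
      finally show "prob (F k) * g j \<le> prob (F k \<inter> E (k + j))" .
    qed
    also have "\<dots> = (\<Sum>l\<in>(+) k ` {1..m}. prob (F k \<inter> E l))"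
      by (rule sum.reindex_cong[OF _ refl, symmetric]) auto
    also have "\<dots> \<le> (\<Sum>l=1..2*m. prob (F k \<inter> E l))"
      using k by (intro sum_mono2) auto
    finally show "(\<Sum>j=1..m. prob (F k) * g j) \<le> (\<Sum>l=1..2*m. prob (F k \<inter> E l))" .
  qed
  also have "\<dots> = (\<Sum>l=1..2*m. \<Sum>k\<le>m. prob (F k \<inter> E l))"
    by (rule sum.swap)
  also have "\<dots> \<le> (\<Sum>l=1..2*m. prob (E l))"
  proof (rule sum_mono)
    fix l
    have "disjoint_family_on (\<lambda>k. F k \<inter> E l) {..m}"
      using disj by (auto simp: disjoint_family_on_def)
    then have "(\<Sum>k\<le>m. prob (F k \<inter> E l)) = prob (\<Union>k\<in>{..m}. F k \<inter> E l)"
      by (intro finite_measure_finite_Union[symmetric]) auto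
    also have "\<dots> \<le> prob (E l)"
      by (intro finite_measure_mono) auto
    finally show "(\<Sum>k\<le>m. prob (F k \<inter> E l)) \<le> prob (E l)" .
  qed
  finally show ?thesis
    unfolding E_def .
qed

context standard_brownian_motion
begin

text \<open>The marginal law of two distinct coordinates: the density is a product over the coordinates, and
each of the others integrates to \<open>1\<close>.\<close>

lemma increment_pair_prob:
  assumes "0 \<le> s" "s < t" "i \<noteq> j"
  shows "prob {\<omega> \<in> space M. \<bar>(B t \<omega> - B s \<omega>) $ i - a\<bar> < r \<and> \<bar>(B t \<omega> - B s \<omega>) $ j - b\<bar> < r}
    = normal_mass (t - s) a r * normal_mass (t - s) b r"
proof -
  define X where "X \<omega> = B t \<omega> - B s \<omega>" for \<omega>
  define \<phi> where "\<phi> = normal_density 0 (sqrt (t - s))"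
  define Q where "Q k = (if k = i then {a - r<..<a + r} else if k = j then {b - r<..<b + r} else UNIV)" for k
  define U where "U = {x :: real ^ 'n. \<bar>x $ i - a\<bar> < r \<and> \<bar>x $ j - b\<bar> < r}"
  have dist: "distributed M lborel X (\<lambda>x. ennreal (\<Prod>i\<in>UNIV. \<phi> (x $ i)))"
    unfolding X_def \<phi>_def by (rule gaussian_increments[OF assms(1,2)])
  have [measurable]: "U \<in> sets borel"
    unfolding U_def by measurable
  have Basis: "(\<Prod>b\<in>(Basis :: (real ^ 'n) set). f b) = (\<Prod>k\<in>UNIV. f (axis k 1))" for f :: "_ \<Rightarrow> ennreal"
  proof -
    have "Basis = (\<lambda>k. axis k 1 :: real ^ 'n) ` UNIV"
      by (auto simp: Basis_vec_def)
    moreover have "inj (\<lambda>k. axis k 1 :: real ^ 'n)"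
      by (auto simp: inj_on_def axis_eq_axis)
    ultimately show ?thesis
      by (intro prod.reindex_cong) auto
  qed
  have int: "(\<integral>\<^sup>+x. ennreal (\<phi> x) * indicator (Q k) x \<partial>lborel) =
      (if k = i then ennreal (normal_mass (t - s) a r) else if k = j then ennreal (normal_mass (t - s) b r) else 1)" for k
  proof -
    interpret N: prob_space "density lborel \<phi>"
      unfolding \<phi>_def using assms by (intro prob_space_normal_density) simp
    have "(\<integral>\<^sup>+x. ennreal (\<phi> x) * indicator UNIV x \<partial>lborel) = 1"
      using N.emeasure_space_1 by (simp add: emeasure_density \<phi>_def)
    then show ?thesis
      using assms by (simp add: Q_def normal_mass_emeasure \<phi>_def)
  qed
  have "emeasure M {\<omega> \<in> space M. X \<omega> \<in> U} = emeasure M (X -` U \<inter> space M)"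
    by (rule arg_cong[where f = "emeasure M"]) auto
  also have "\<dots> = (\<integral>\<^sup>+x. ennreal (\<Prod>k\<in>UNIV. \<phi> (x $ k)) * indicator U x \<partial>lborel)"
    by (rule distributed_emeasure[OF dist]) simp
  also have "\<dots> = (\<integral>\<^sup>+x. (\<Prod>k\<in>UNIV. ennreal (\<phi> (x $ k)) * indicator (Q k) (x $ k)) \<partial>lborel)"
  proof (rule nn_integral_cong)
    fix x :: "real ^ 'n"
    have "indicator U x = (\<Prod>k\<in>UNIV. indicator (Q k) (x $ k) :: ennreal)"
    proof (cases "x \<in> U")
      case True
      then have "x $ k \<in> Q k" for k
        by (auto simp: U_def Q_def)
      then show ?thesis
        using True by simp
    next
      case False
      then have "x $ i \<notin> Q i \<or> x $ j \<notin> Q j"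
        using assms(3) by (auto simp: U_def Q_def)
      then have "\<exists>k. indicator (Q k) (x $ k) = (0 :: ennreal)"
        by (metis indicator_simps(2))
      then show ?thesis
        using False by (simp add: prod_zero_iff)
    qed
    then show "ennreal (\<Prod>k\<in>UNIV. \<phi> (x $ k)) * indicator U x
        = (\<Prod>k\<in>UNIV. ennreal (\<phi> (x $ k)) * indicator (Q k) (x $ k))"
      by (simp add: prod.distrib prod_ennreal \<phi>_def)
  qed
  also have "\<dots> = (\<integral>\<^sup>+x. (\<Prod>b\<in>Basis. ennreal (\<phi> (x \<bullet> b)) * indicator (Q (axis_index b)) (x \<bullet> b)) \<partial>(lborel :: (real ^ 'n) measure))"
    by (simp add: Basis inner_axis)
  also have "\<dots> = (\<Prod>b\<in>(Basis :: (real ^ 'n) set). \<integral>\<^sup>+x. ennreal (\<phi> x) * indicator (Q (axis_index b)) x \<partial>lborel)"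
    by (rule nn_integral_lborel_prod) (auto simp: \<phi>_def Q_def)
  also have "\<dots> = (\<Prod>k\<in>UNIV. \<integral>\<^sup>+x. ennreal (\<phi> x) * indicator (Q k) x \<partial>lborel)"
    by (simp add: Basis)
  also have "\<dots> = (\<Prod>k\<in>{i, j}. \<integral>\<^sup>+x. ennreal (\<phi> x) * indicator (Q k) x \<partial>lborel)"
    by (rule prod.mono_neutral_right) (auto simp: int)
  also have "\<dots> = ennreal (normal_mass (t - s) a r * normal_mass (t - s) b r)"
    using assms(3) by (simp add: int ennreal_mult normal_mass_nonneg)
  finally show ?thesis
    by (simp add: emeasure_eq_measure X_def U_def normal_mass_nonneg)
qed

text \<open>The hypothesis of the first entrance bound for Brownian motion sampled with mesh \<open>h\<close>. The walk up to
step \<open>k\<close> is a function of the increments before time \<open>k h\<close>, which are independent of the single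
increment over \<open>[k h, (k + j) h]\<close>.\<close>

lemma walk_markov:
  assumes "0 \<le> h" and [measurable]: "H \<in> sets borel" "G \<in> sets borel"
  defines "S \<equiv> \<lambda>k \<omega>. B (real k * h) \<omega> - B 0 \<omega>"
  shows "prob {\<omega> \<in> space M. (S k \<omega> \<in> H \<and> (\<forall>l<k. S l \<omega> \<notin> H)) \<and> S (k + j) \<omega> - S k \<omega> \<in> G} =
      prob {\<omega> \<in> space M. S k \<omega> \<in> H \<and> (\<forall>l<k. S l \<omega> \<notin> H)}
      * prob {\<omega> \<in> space M. S (k + j) \<omega> - S k \<omega> \<in> G}"
proof -
  \<comment> \<open>after step \<open>k\<close> the partition jumps directly to time \<open>(k + j) h\<close>, so increment \<open>k\<close> is the future one\<close>
  define \<tau> where "\<tau> i = (if i \<le> k then real i * h else real (k + j) * h)" for i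
  define \<Delta> where "\<Delta> i \<omega> = B (\<tau> (Suc i)) \<omega> - B (\<tau> i) \<omega>" for i \<omega>
  have "indep_vars (\<lambda>_. borel) \<Delta> {..<Suc k}"
    unfolding \<Delta>_def
    using assms(1) by (intro independent_increments) (auto simp: \<tau>_def intro!: mult_right_mono)
  then have indep: "indep_var (PiM {..<k} (\<lambda>_. borel)) (\<lambda>\<omega>. restrict (\<lambda>i. \<Delta> i \<omega>) {..<k})
      (PiM {k} (\<lambda>_. borel)) (\<lambda>\<omega>. restrict (\<lambda>i. \<Delta> i \<omega>) {k})"
    by (rule indep_var_restrict) auto
  define E1 where "E1 = {f \<in> space (PiM {..<k} (\<lambda>_. borel :: (real ^ 'n) measure)).
      (\<Sum>i<k. f i) \<in> H \<and> (\<forall>l\<in>{..<k}. (\<Sum>i<l. f i) \<notin> H)}"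
  define E2 where "E2 = {f \<in> space (PiM {k} (\<lambda>_. borel :: (real ^ 'n) measure)). f k \<in> G}"
  have sum_meas: "(\<lambda>f. \<Sum>i<l. f i) \<in> borel_measurable (PiM {..<k} (\<lambda>_. borel :: (real ^ 'n) measure))"
    if "l \<le> k" for l
    using that by (intro borel_measurable_sum measurable_component_singleton) auto
  have E1: "E1 \<in> sets (PiM {..<k} (\<lambda>_. borel))"
    unfolding E1_def
    by (intro sets.sets_Collect_conj sets.sets_Collect_finite_All sets.sets_Collect_neg
        measurable_sets_Collect[OF sum_meas]) auto
  have E2: "E2 \<in> sets (PiM {k} (\<lambda>_. borel))"
    unfolding E2_def by measurable
  have walk: "(\<Sum>i<l. \<Delta> i \<omega>) = S l \<omega>" if "l \<le> k" for l \<omega>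
  proof -
    have "(\<Sum>i<l. \<Delta> i \<omega>) = (\<Sum>i<l. B (real (Suc i) * h) \<omega> - B (real i * h) \<omega>)"
      using that by (intro sum.cong) (auto simp: \<Delta>_def \<tau>_def)
    also have "\<dots> = S l \<omega>"
      unfolding S_def by (subst sum_lessThan_telescope) simp
    finally show ?thesis .
  qed
  have last: "\<Delta> k \<omega> = S (k + j) \<omega> - S k \<omega>" for \<omega>
    by (simp add: \<Delta>_def \<tau>_def S_def)
  have past: "restrict (\<lambda>i. \<Delta> i \<omega>) {..<k} \<in> E1 \<longleftrightarrow> S k \<omega> \<in> H \<and> (\<forall>l<k. S l \<omega> \<notin> H)" for \<omega>
  proof -
    have "(\<Sum>i<l. restrict (\<lambda>i. \<Delta> i \<omega>) {..<k} i) = S l \<omega>" if "l \<le> k" for l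
      unfolding walk[OF that, of \<omega>, symmetric] using that by (intro sum.cong) auto
    then show ?thesis
      by (auto simp: E1_def space_PiM)
  qed
  have future: "restrict (\<lambda>i. \<Delta> i \<omega>) {k} \<in> E2 \<longleftrightarrow> S (k + j) \<omega> - S k \<omega> \<in> G" for \<omega>
    by (simp add: E2_def space_PiM last)
  show ?thesis
    using indep_varD[OF indep E1 E2]
    by (simp add: past future vimage_def Int_def conj_ac cong: conj_cong)
qed

text \<open>The quantitative heart, uniform in the mesh \<open>T/2\<^sup>n\<close>. With \<open>r = 2\<^sup>-\<^sup>q\<close> the expected number of visits to
the square of half-side \<open>2 r\<close> is at most \<open>128 m r\<^sup>2 / (\<pi> a\<^sup>2)\<close>, and the expected number of returns is at
least \<open>2 r\<^sup>2 q / (\<pi> e h)\<close>, where \<open>m h = T\<close>. The quotient decays like \<open>1/q\<close>, which is the reciprocal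
of the logarithm of the scale.\<close>

lemma grid_hit_prob_le:
  assumes "i \<noteq> j" "a \<noteq> 0" "1 \<le> T" "0 < q" "2 * q \<le> n" "(1 / 2) ^ q \<le> \<bar>a\<bar> / 4"
  shows "prob {\<omega> \<in> space M. \<exists>k\<le>2 ^ n. \<bar>(B (real k * (T / 2 ^ n)) \<omega> - B 0 \<omega>) $ i - a\<bar> < (1 / 2) ^ q
      \<and> \<bar>(B (real k * (T / 2 ^ n)) \<omega> - B 0 \<omega>) $ j - b\<bar> < (1 / 2) ^ q}
    \<le> 64 * exp 1 * T / (a\<^sup>2 * q)"
proof -
  define r :: real where "r = (1 / 2) ^ q"
  define h where "h = T / 2 ^ n"
  define m :: nat where "m = 2 ^ n"
  define S where "S k \<omega> = B (real k * h) \<omega> - B 0 \<omega>" for k \<omega>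
  define near where "near a b r = {v :: real ^ 'n. \<bar>v $ i - a\<bar> < r \<and> \<bar>v $ j - b\<bar> < r}" for a b r
  define P where "P = prob {\<omega> \<in> space M. \<exists>k\<le>m. S k \<omega> \<in> near a b r}"
  have pos: "0 < r" "0 < h" "0 < m" "real m * h = T"
    using assms by (auto simp: r_def h_def m_def)
  have [measurable]: "near a b r \<in> sets borel" for a b r
    unfolding near_def by measurable
  have meas [measurable]: "S k \<in> borel_measurable M" for k
    unfolding S_def using pos by (intro borel_measurable_diff random_variable) auto
  have step: "prob {\<omega> \<in> space M. S (k + l) \<omega> - S k \<omega> \<in> near a b r} =
      normal_mass (real l * h) a r * normal_mass (real l * h) b r" if "1 \<le> l" for k l a b r
  proof -
    have "S (k + l) \<omega> - S k \<omega> = B (real (k + l) * h) \<omega> - B (real k * h) \<omega>" for \<omega>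
      by (simp add: S_def)
    moreover have "real (k + l) * h - real k * h = real l * h"
      by (simp add: algebra_simps)
    ultimately show ?thesis
      using increment_pair_prob[of "real k * h" "real (k + l) * h" i j a r b] pos that assms(1)
      by (simp add: near_def)
  qed
  have bound: "P * (\<Sum>l=1..m. normal_mass (real l * h) 0 r * normal_mass (real l * h) 0 r)
      \<le> (\<Sum>l=1..2*m. prob {\<omega> \<in> space M. S l \<omega> \<in> near a b (2 * r)})"
    unfolding P_def
  proof (rule first_entrance_bound)
    fix k l :: nat assume "1 \<le> l"
    show "prob {\<omega> \<in> space M. (S k \<omega> \<in> near a b r \<and> (\<forall>l<k. S l \<omega> \<notin> near a b r))
          \<and> S (k + l) \<omega> - S k \<omega> \<in> near 0 0 r} =
        prob {\<omega> \<in> space M. S k \<omega> \<in> near a b r \<and> (\<forall>l<k. S l \<omega> \<notin> near a b r)}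
          * (normal_mass (real l * h) 0 r * normal_mass (real l * h) 0 r)"
      unfolding step[OF \<open>1 \<le> l\<close>, of k 0 0 r, symmetric] unfolding S_def
      using pos by (intro walk_markov) auto
  next
    fix u v assume "u \<in> near a b r" "v \<in> near 0 0 r"
    then show "u + v \<in> near a b (2 * r)"
      by (auto simp: near_def)
  qed auto
  have "(\<Sum>l=1..2*m. prob {\<omega> \<in> space M. S l \<omega> \<in> near a b (2 * r)}) \<le> (\<Sum>l=1..2*m. 16 * (2 * r)\<^sup>2 / (pi * a\<^sup>2))"
  proof (rule sum_mono)
    fix l assume l: "l \<in> {1..2*m}"
    have "prob {\<omega> \<in> space M. S l \<omega> \<in> near a b (2 * r)} =
        normal_mass (real l * h) a (2 * r) * normal_mass (real l * h) b (2 * r)"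
      using step[of l 0 a b "2 * r"] l by (simp add: S_def)
    also have "\<dots> \<le> 16 * (2 * r)\<^sup>2 / (pi * a\<^sup>2)"
      using l pos assms(6) by (intro normal_mass_product_le) (auto simp: r_def)
    finally show "prob {\<omega> \<in> space M. S l \<omega> \<in> near a b (2 * r)} \<le> 16 * (2 * r)\<^sup>2 / (pi * a\<^sup>2)" .
  qed
  also have "\<dots> = 128 * m * r\<^sup>2 / (pi * a\<^sup>2)"
    by (simp add: power_mult_distrib)
  finally have upper: "P * (\<Sum>l=1..m. normal_mass (real l * h) 0 r * normal_mass (real l * h) 0 r)
      \<le> 128 * m * r\<^sup>2 / (pi * a\<^sup>2)"
    using bound by simp
  \<comment> \<open>the steps \<open>l\<close> with \<open>r\<^sup>2 \<le> l h\<close> include \<open>2 q\<close> dyadic blocks, each contributing \<open>1/2\<close> to the harmonic sum\<close>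
  have "2 * r\<^sup>2 / (pi * exp 1 * h) * q
      \<le> 2 * r\<^sup>2 / (pi * exp 1 * h) * (\<Sum>l\<in>{2 ^ (n - 2 * q)<..2 ^ n}. 1 / real l)"
    using harmonic_block_sum_ge[of "2 * q" "n - 2 * q"] assms(5) pos
    by (intro mult_left_mono) auto
  also have "\<dots> = (\<Sum>l\<in>{2 ^ (n - 2 * q)<..m}. 2 * r\<^sup>2 / (pi * exp 1 * (real l * h)))"
    unfolding sum_distrib_left m_def by (intro sum.cong) auto
  also have "\<dots> \<le> (\<Sum>l\<in>{2 ^ (n - 2 * q)<..m}. normal_mass (real l * h) 0 r * normal_mass (real l * h) 0 r)"
  proof (intro sum_mono normal_mass_square_ge)
    fix l assume l: "l \<in> {2 ^ (n - 2 * q)<..m}"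
    have "(2 :: real) ^ n = 2 ^ (n - 2 * q) * (2 ^ q)\<^sup>2"
      using assms(5) by (simp flip: power_mult power_add add: mult.commute)
    then have "r\<^sup>2 = 2 ^ (n - 2 * q) / 2 ^ n"
      by (simp add: r_def power_divide)
    also have "\<dots> \<le> real l / 2 ^ n"
    proof (rule divide_right_mono)
      have "real (2 ^ (n - 2 * q)) \<le> real l"
        using l by (simp only: of_nat_le_iff) simp
      then show "2 ^ (n - 2 * q) \<le> real l"
        by simp
    qed simp
    also have "\<dots> \<le> real l / 2 ^ n * T"
      using mult_left_mono[OF assms(3), of "real l / 2 ^ n"] by simp
    finally show "r\<^sup>2 \<le> real l * h"
      by (simp add: h_def)
  qed (rule pos)
  also have "\<dots> \<le> (\<Sum>l=1..m. normal_mass (real l * h) 0 r * normal_mass (real l * h) 0 r)"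
    by (intro sum_mono2) (auto simp: normal_mass_nonneg)
  finally have "P * (2 * r\<^sup>2 / (pi * exp 1 * h) * q) \<le> 128 * m * r\<^sup>2 / (pi * a\<^sup>2)"
    by (rule order_trans[OF mult_left_mono upper]) (simp add: P_def)
  moreover have "0 < 2 * r\<^sup>2 / (pi * exp 1 * h) * q"
    using pos assms(4) by simp
  ultimately have "P \<le> 128 * m * r\<^sup>2 / (pi * a\<^sup>2) / (2 * r\<^sup>2 / (pi * exp 1 * h) * q)"
    by (simp only: pos_le_divide_eq)
  also have "\<dots> = 64 * exp 1 * (m * h) / (a\<^sup>2 * q)"
    using pos(1-3) by (simp add: mult_ac)
  finally have "P \<le> 64 * exp 1 * T / (a\<^sup>2 * q)"
    by (simp only: pos(4))
  then show ?thesis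
    by (simp add: P_def S_def near_def m_def r_def h_def)
qed

text \<open>Dyadic grids are nested, so the events increase with \<open>n\<close> and the uniform bound passes to the limit.\<close>

lemma dyadic_hit_prob_le:
  assumes "i \<noteq> j" "a \<noteq> 0" "1 \<le> T" "0 < q" "(1 / 2) ^ q \<le> \<bar>a\<bar> / 4"
  shows "prob {\<omega> \<in> space M. \<exists>n. \<exists>k\<le>2 ^ n.
      \<bar>(B (real k * (T / 2 ^ n)) \<omega> - B 0 \<omega>) $ i - a\<bar> < (1 / 2) ^ q
      \<and> \<bar>(B (real k * (T / 2 ^ n)) \<omega> - B 0 \<omega>) $ j - b\<bar> < (1 / 2) ^ q}
    \<le> 64 * exp 1 * T / (a\<^sup>2 * q)"
proof -
  define hit where "hit n = {\<omega> \<in> space M. \<exists>k\<le>2 ^ n.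
      \<bar>(B (real k * (T / 2 ^ n)) \<omega> - B 0 \<omega>) $ i - a\<bar> < (1 / 2) ^ q
      \<and> \<bar>(B (real k * (T / 2 ^ n)) \<omega> - B 0 \<omega>) $ j - b\<bar> < (1 / 2) ^ q}" for n
  have [measurable]: "B (real k * (T / 2 ^ n)) \<in> borel_measurable M" "B 0 \<in> borel_measurable M" for k n
    using assms(3) by (auto intro!: random_variable)
  have "range hit \<subseteq> events"
    unfolding hit_def by (intro image_subsetI) measurable
  moreover have "incseq hit"
  proof (rule incseq_SucI, rule subsetI)
    fix n \<omega> assume "\<omega> \<in> hit n"
    then obtain k where k: "\<omega> \<in> space M" "k \<le> 2 ^ n"
        "\<bar>(B (real k * (T / 2 ^ n)) \<omega> - B 0 \<omega>) $ i - a\<bar> < (1 / 2) ^ q"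
        "\<bar>(B (real k * (T / 2 ^ n)) \<omega> - B 0 \<omega>) $ j - b\<bar> < (1 / 2) ^ q"
      unfolding hit_def by blast
    have "real (2 * k) * (T / 2 ^ Suc n) = real k * (T / 2 ^ n)"
      by simp
    then show "\<omega> \<in> hit (Suc n)"
      unfolding hit_def using k by (intro CollectI conjI exI[of _ "2 * k"]) simp_all
  qed
  ultimately have "(\<lambda>n. prob (hit n)) \<longlonglongrightarrow> prob (\<Union>n. hit n)"
    by (rule finite_Lim_measure_incseq)
  then have "prob (\<Union>n. hit n) \<le> 64 * exp 1 * T / (a\<^sup>2 * q)"
  proof (rule LIMSEQ_le_const2)
    show "\<exists>N. \<forall>n\<ge>N. prob (hit n) \<le> 64 * exp 1 * T / (a\<^sup>2 * q)"
      unfolding hit_def using grid_hit_prob_le[OF assms(1-4) _ assms(5)]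
      by (intro exI[of _ "2 * q"]) auto
  qed
  also have "(\<Union>n. hit n) = {\<omega> \<in> space M. \<exists>n. \<exists>k\<le>2 ^ n.
      \<bar>(B (real k * (T / 2 ^ n)) \<omega> - B 0 \<omega>) $ i - a\<bar> < (1 / 2) ^ q
      \<and> \<bar>(B (real k * (T / 2 ^ n)) \<omega> - B 0 \<omega>) $ j - b\<bar> < (1 / 2) ^ q}"
    unfolding hit_def by auto
  finally show ?thesis .
qed

text \<open>By continuity of the path, hitting \<open>(a, b)\<close> exactly implies entering every neighbourhood at some
time of a dyadic subdivision, which has probability \<open>0\<close> by letting \<open>q\<close> tend to infinity.\<close>

lemma AE_avoids_pair_upto:
  assumes "i \<noteq> j" "a \<noteq> 0" "1 \<le> T"
  shows "AE \<omega> in M. \<forall>t\<in>{0..T}. \<not> (B t \<omega> $ i = a \<and> B t \<omega> $ j = b)"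
proof -
  define near where "near q = {\<omega> \<in> space M. \<exists>n. \<exists>k\<le>2 ^ n.
      \<bar>(B (real k * (T / 2 ^ n)) \<omega> - B 0 \<omega>) $ i - a\<bar> < (1 / 2) ^ q
      \<and> \<bar>(B (real k * (T / 2 ^ n)) \<omega> - B 0 \<omega>) $ j - b\<bar> < (1 / 2) ^ q}" for q :: nat
  have [measurable]: "B (real k * (T / 2 ^ n)) \<in> borel_measurable M" "B 0 \<in> borel_measurable M" for k n
    using assms(3) by (auto intro!: random_variable)
  have near_meas: "near q \<in> events" for q
    unfolding near_def by measurable
  then have Inter: "(\<Inter>q. near q) \<in> events"
    by auto
  have "prob (\<Inter>q. near q) \<le> 0"
  proof (rule LIMSEQ_le_const)
    show "(\<lambda>q. (64 * exp 1 * T / a\<^sup>2) / real q) \<longlonglongrightarrow> 0"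
      by (rule lim_const_over_n)
    have "(\<lambda>q. (1 / 2 :: real) ^ q) \<longlonglongrightarrow> 0"
      by (rule LIMSEQ_realpow_zero) auto
    then have "eventually (\<lambda>q. (1 / 2 :: real) ^ q < \<bar>a\<bar> / 4) sequentially"
      using assms(2) by (intro order_tendstoD) auto
    then obtain q0 where q0: "\<And>q. q \<ge> q0 \<Longrightarrow> (1 / 2 :: real) ^ q < \<bar>a\<bar> / 4"
      unfolding eventually_sequentially by blast
    have "prob (\<Inter>q. near q) \<le> (64 * exp 1 * T / a\<^sup>2) / real q" if "q \<ge> Suc q0" for q
    proof -
      have "prob (\<Inter>q. near q) \<le> prob (near q)"
        using near_meas by (intro finite_measure_mono) auto
      also have "\<dots> \<le> 64 * exp 1 * T / (a\<^sup>2 * q)"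
        unfolding near_def using q0[of q] that by (intro dyadic_hit_prob_le assms) auto
      finally show ?thesis
        by simp
    qed
    then show "\<exists>N. \<forall>q\<ge>N. prob (\<Inter>q. near q) \<le> (64 * exp 1 * T / a\<^sup>2) / real q"
      by blast
  qed
  then have "prob (\<Inter>q. near q) = 0"
    using measure_nonneg[of M "\<Inter>q. near q"] by linarith
  then have "AE \<omega> in M. \<omega> \<notin> (\<Inter>q. near q)"
    using prob_eq_0[OF Inter] by simp
  then show ?thesis
    using start continuous_paths AE_space
  proof eventually_elim
    case (elim \<omega>)
    show ?case
    proof (rule ballI, rule notI)
      fix t assume t: "t \<in> {0..T}" and hit: "B t \<omega> $ i = a \<and> B t \<omega> $ j = b"
      obtain q where q: "\<omega> \<notin> near q"
        using elim by blast
      define r :: real where "r = (1 / 2) ^ q"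
      have "0 < r"
        by (simp add: r_def)
      have "continuous (at t within {0..}) (\<lambda>s. B s \<omega>)"
        using elim t by (simp add: continuous_on_eq_continuous_within)
      then obtain d where d: "0 < d" "\<And>s. 0 \<le> s \<Longrightarrow> dist s t < d \<Longrightarrow> dist (B s \<omega>) (B t \<omega>) < r"
        unfolding continuous_within_eps_delta using \<open>0 < r\<close> by (metis atLeast_iff)
      obtain n where n: "(1 / 2) ^ n < d / T"
        using real_arch_pow_inv[of "d / T" "1 / 2"] d(1) assms(3) by auto
      define k where "k = nat \<lfloor>t * 2 ^ n / T\<rfloor>"
      have k: "real k \<le> t * 2 ^ n / T" "t * 2 ^ n / T < real k + 1"
        using t assms(3) by (auto simp: k_def)
      have "t * 2 ^ n / T \<le> 2 ^ n"
        using t assms(3) by (simp add: field_simps)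
      with k(1) have "real k \<le> real (2 ^ n)"
        by (simp only: of_nat_power of_nat_numeral)
      then have "k \<le> 2 ^ n"
        by (simp only: of_nat_le_iff)
      have "real k * (T / 2 ^ n) \<le> t" "t < real k * (T / 2 ^ n) + T / 2 ^ n"
        using k assms(3) by (auto simp: field_simps)
      moreover have "T / 2 ^ n < d"
        using n assms(3) by (simp add: power_divide field_simps)
      ultimately have "dist (real k * (T / 2 ^ n)) t < d"
        by (simp add: dist_real_def)
      then have "norm (B (real k * (T / 2 ^ n)) \<omega> - B t \<omega>) < r"
        using d(2) assms(3) by (simp add: dist_norm)
      then have "\<bar>(B (real k * (T / 2 ^ n)) \<omega> - B t \<omega>) $ l\<bar> < r" for l
        using component_le_norm_cart le_less_trans by blast
      from this[of i] this[of j] have "\<omega> \<in> near q"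
        unfolding near_def using elim hit \<open>k \<le> 2 ^ n\<close> by (auto simp: r_def)
      with q show False
        by blast
    qed
  qed
qed

lemma AE_avoids_pair:
  assumes "i \<noteq> j" "a \<noteq> 0"
  shows "AE \<omega> in M. \<forall>t\<ge>0. \<not> (B t \<omega> $ i = a \<and> B t \<omega> $ j = b)"
proof -
  have "AE \<omega> in M. \<forall>N :: nat. \<forall>t\<in>{0..real (Suc N)}. \<not> (B t \<omega> $ i = a \<and> B t \<omega> $ j = b)"
    unfolding AE_all_countable using AE_avoids_pair_upto[OF assms] by simp
  then show ?thesis
  proof eventually_elim
    case (elim \<omega>)
    show ?case
    proof (intro allI impI)
      fix t :: real assume "0 \<le> t"
      moreover obtain N :: nat where "t \<le> real N"
        using real_arch_simple by blast
      ultimately have "t \<in> {0..real (Suc N)}"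
        by simp
      then show "\<not> (B t \<omega> $ i = a \<and> B t \<omega> $ j = b)"
        using elim by blast
    qed
  qed
qed

end

section \<open>The complement of the Brownian path\<close>

lemma closure_translated_Rats: "closure ((\<lambda>q. c + q) ` \<rat>) = (UNIV :: real set)"
proof -
  have "\<exists>y\<in>(\<lambda>q. c + q) ` \<rat>. dist y x < e" if "0 < e" for x e :: real
  proof -
    obtain q where "q \<in> \<rat>" "x - c < q" "q < x - c + e"
      using Rats_dense_in_real[of "x - c" "x - c + e"] \<open>0 < e\<close> by auto
    then show ?thesis
      by (intro bexI[of _ "c + q"]) (auto simp: dist_real_def)
  qed
  then show ?thesis
    by (auto simp: closure_approachable)
qed

theorem proposition1p11:
  fixes M :: "'a measure"
    and x\<^sub>0 :: "'n::finite torus"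
    and W :: "real \<Rightarrow> 'a \<Rightarrow> 'n torus"
  assumes "CARD('n) \<ge> 3"
    and "torus_brownian_motion M x\<^sub>0 W"
  shows "AE \<omega> in M.
    (\<forall>t\<ge>0.
      path_connected (UNIV - (\<lambda>s. W s \<omega>) ` {0..t}) \<and>
      open (UNIV - (\<lambda>s. W s \<omega>) ` {0..t}) \<and>
      closure (UNIV - (\<lambda>s. W s \<omega>) ` {0..t}) = UNIV) \<and>
    path_connected (UNIV - (\<lambda>s. W s \<omega>) ` {0..}) \<and>
    locally path_connected (UNIV - (\<lambda>s. W s \<omega>) ` {0..}) \<and>
    closure (UNIV - (\<lambda>s. W s \<omega>) ` {0..}) = UNIV"
proof -
  obtain B where "standard_brownian_motion M B"
    and W: "\<And>t \<omega>. 0 \<le> t \<Longrightarrow> \<omega> \<in> space M \<Longrightarrow> W t \<omega> = torus_translate (B t \<omega>) x\<^sub>0"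
    using assms(2) unfolding torus_brownian_motion_def by blast
  then interpret standard_brownian_motion M B
    by simp
  obtain x where x: "x\<^sub>0 = torus_proj x"
    using torus_proj_surj by blast
  obtain c :: real where c: "c \<notin> \<rat>"
    using countable_rat uncountable_UNIV_real by (metis UNIV_eq_I)
  define D where "D i = (\<lambda>q. (x $ i + c) + q) ` \<rat>" for i
  have dense: "closure (D i) = UNIV" for i
    unfolding D_def by (rule closure_translated_Rats)
  \<comment> \<open>the index pairs and target points that a visit to the skeleton could use\<close>
  define I where "I = {(i, j, p, q). (i :: 'n) \<noteq> j \<and> p \<in> (\<rat> :: real set) \<and> q \<in> (\<rat> :: real set)}"
  have "countable I"
  proof (rule countable_subset)
    show "I \<subseteq> UNIV \<times> UNIV \<times> \<rat> \<times> \<rat>"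
      by (auto simp: I_def)
    show "countable ((UNIV :: 'n set) \<times> (UNIV :: 'n set) \<times> (\<rat> :: real set) \<times> (\<rat> :: real set))"
      by (intro countable_SIGMA countable_rat) (auto intro: countable_finite)
  qed
  moreover have "AE \<omega> in M. \<forall>t\<ge>0. \<not> (B t \<omega> $ i = c + p \<and> B t \<omega> $ j = c + q)"
    if "(i, j, p, q) \<in> I" for i j p q
  proof (rule AE_avoids_pair)
    show "c + p \<noteq> 0"
      using c that by (auto simp: I_def add_eq_0_iff2)
  qed (use that in \<open>auto simp: I_def\<close>)
  ultimately have "AE \<omega> in M. \<forall>(i, j, p, q)\<in>I. \<forall>t\<ge>0. \<not> (B t \<omega> $ i = c + p \<and> B t \<omega> $ j = c + q)"
    by (subst AE_ball_countable) auto
  then show ?thesis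
    using continuous_paths AE_space
  proof eventually_elim
    case (elim \<omega>)
    have proj: "W s \<omega> = torus_proj (x + B s \<omega>)" if "0 \<le> s" for s
      using W[OF that elim(3)] by (simp add: x torus_translate_proj)
    have avoid: "torus_proj -` (\<lambda>s. W s \<omega>) ` {0..} \<inter> axis_skeleton D = {}"
    proof (rule ccontr)
      assume "torus_proj -` (\<lambda>s. W s \<omega>) ` {0..} \<inter> axis_skeleton D \<noteq> {}"
      then obtain v s where v: "v \<in> axis_skeleton D" and s: "0 \<le> s" "torus_proj v = W s \<omega>"
        by auto
      obtain k where k: "\<And>i. i \<noteq> k \<Longrightarrow> v $ i \<in> D i"
        using v unfolding axis_skeleton_def by blast
      have hit: "\<exists>p\<in>\<rat>. B s \<omega> $ i = c + p" if "i \<noteq> k" for i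
      proof -
        obtain q where q: "q \<in> \<rat>" "v $ i = x $ i + c + q"
          using k[OF \<open>i \<noteq> k\<close>] by (auto simp: D_def)
        have "torus_proj v = torus_proj (x + B s \<omega>)"
          using s proj by simp
        then have "v $ i - (x + B s \<omega>) $ i \<in> \<int>"
          unfolding torus_proj_eq_iff by blast
        then have "v $ i - (x + B s \<omega>) $ i \<in> \<rat>"
          using Ints_subset_Rats by blast
        with q(1) have "q - (v $ i - (x + B s \<omega>) $ i) \<in> \<rat>"
          by (rule Rats_diff)
        moreover have "B s \<omega> $ i = c + (q - (v $ i - (x + B s \<omega>) $ i))"
          using q by simp
        ultimately show ?thesis
          by blast
      qed
      have ex: "\<exists>l. l \<notin> {k, i}" for i :: 'n
      proof (rule ccontr)
        assume "\<nexists>l. l \<notin> {k, i}"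
        then have "(UNIV :: 'n set) = {k, i}"
          by blast
        then have "CARD('n) = card {k, i}"
          by simp
        then show False
          using assms(1) by (simp add: card_insert_if split: if_splits)
      qed
      obtain i j where ij: "i \<noteq> k" "j \<noteq> k" "i \<noteq> j"
        using ex[of k] ex by blast
      obtain p q where "p \<in> \<rat>" "B s \<omega> $ i = c + p" "q \<in> \<rat>" "B s \<omega> $ j = c + q"
        using hit[OF ij(1)] hit[OF ij(2)] by blast
      moreover from this have "(i, j, p, q) \<in> I"
        using ij by (simp add: I_def)
      ultimately show False
        using elim(1) \<open>0 \<le> s\<close> by blast
    qed
    have "torus_proj -` (\<lambda>s. W s \<omega>) ` {0..t} \<inter> axis_skeleton D = {}" for t
      using avoid by (auto simp: disjoint_iff)
    then have upto: "path_connected (UNIV - (\<lambda>s. W s \<omega>) ` {0..t})"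
        "closure (UNIV - (\<lambda>s. W s \<omega>) ` {0..t}) = UNIV" for t
      using torus_complement_connectivity[of D, OF dense] by auto
    have "open (UNIV - (\<lambda>s. W s \<omega>) ` {0..t})" for t
    proof -
      have "continuous_on {0..t} (\<lambda>s. x + B s \<omega>)"
        using elim(2) by (intro continuous_intros) (auto intro: continuous_on_subset)
      then have "closed (torus_proj ` (\<lambda>s. x + B s \<omega>) ` {0..t})"
        by (intro closed_torus_proj_image compact_continuous_image) auto
      also have "torus_proj ` (\<lambda>s. x + B s \<omega>) ` {0..t} = (\<lambda>s. W s \<omega>) ` {0..t}"
        unfolding image_image by (intro image_cong) (auto simp: proj)
      finally show ?thesis
        by (rule open_Diff[OF open_UNIV])
    qed
    with upto torus_complement_connectivity[of D, OF dense avoid] show ?case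
      by blast
  qed
qed

end
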